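(* For every formula $\varphi$ of the language of monadic second-order logic over $\omega$-words, if $\vdash\varphi$ is derivable in $\mathsf{MSO}$, then $\vdash\lnot\lnot\varphi$ is derivable in $\mathsf{SMSO}$. (More generally, if $\vec\varphi\vdash\varphi$ is derivable in $\mathsf{MSO}$ then $\vec\varphi\vdash\lnot\lnot\varphi$ is derivable in $\mathsf{SMSO}$.)
   Context: \emph{Language.} Two-sorted: individual variables $x,y,z,\dots$, predicate variables $X,Y,Z,\dots$. Atomic formulae $\alpha$: $x\doteq y$, $x\leq y$, $\mathsf S(x,y)$, $\mathsf{Zero}(x)$, $x\in X$, $\top$, $\bot$. Deterministic formulae $\delta ::= \alpha\mid\delta\wedge\delta'\mid\lnot\varphi$; formulae $\varphi ::= \delta\mid\varphi\wedge\psi\mid\exists x\varphi\mid\exists X\varphi$ (no primitive $\vee,\to,\forall$). \emph{Substitution.} $\varphi[\psi[y]/X]$ is capture-avoiding replacement of every atom $t\in X$ by $\psi[t/y]$. \emph{Relativization:} $\alpha|\theta[y]:=\alpha$, commuting with $\wedge,\lnot,\exists X$, and $(\exists x\varphi)|\theta[y]:=\exists x(\theta[x/y]\wedge\varphi|\theta[y])$. A formula is \emph{uniformly bounded by $x$} if it has the form $\psi|(y\leq x)[y]$ and $x$ is its only free individual variable. \emph{Logical rules} (sequents $\vec\varphi\vdash\varphi$): axiom $\vec\varphi,\varphi\vdash\varphi$; cut; from $\vec\varphi\vdash\varphi$, $\vec\varphi\vdash\lnot\varphi$ infer $\vec\varphi\vdash\bot$; from $\vec\varphi,\varphi\vdash\bot$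 infer $\vec\varphi\vdash\lnot\varphi$; $\wedge$-intro and $\wedge$-eliminations; $\exists$-introductions from $\varphi[y/x]$ resp. $\varphi[Y/X]$; $\exists$-eliminations (from $\vec\varphi\vdash\exists x\varphi$ and $\vec\varphi,\varphi\vdash\psi$ infer $\vec\varphi\vdash\psi$, $x$ not free in $\vec\varphi,\psi$; same for $X$). \emph{Arithmetic rules} (common context $\vec\varphi$): $\vdash x\doteq x$; from $\varphi[y/x]$, $y\doteq z$ infer $\varphi[z/x]$; reflexivity, transitivity of $\leq$ and from $x\leq y,y\leq x$ infer $x\doteq y$; $\vdash\exists y\,\mathsf{Zero}(y)$; from $\mathsf{Zero}(x),\mathsf{Zero}(y)$ infer $x\doteq y$; $\vdash\exists y\,\mathsf S(x,y)$; from $\mathsf S(y,x),\mathsf S(z,x)$ infer $y\doteq z$; from $\mathsf S(x,y),\mathsf S(x,z)$ infer $y\doteq z$; from $\mathsf S(x,y),\mathsf{Zero}(y)$ infer $\bot$; from $\mathsf S(x,y)$ infer $x\leq y$; from $\mathsf S(y,y')$, $x\leq y'$, $\lnot(x\doteq y')$ infer $x\leq y$. \emph{$\mathsf{MSO}$}: logical and arithmetic rules, plus double negation elimination (from $\vec\varphi\vdash\lnot\lnot\varphi$ infer $\vec\varphi\vdash\varphi$), comprehension (from $\vec\varphi\vdash\varphi[\psi[y]/X]$ infer $\vec\varphi\vdash\exists X\varphi$) and induction (from $\vec\varphi,\mathsf{Zero}(z)\vdash\varphi[z/x]$ and $\vec\varphi,\mathsf S(y,z),\varphi[y/x]\vdash\varphi[z/x]$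 infer $\vec\varphi\vdash\varphi$, with $y,z$ not free in $\vec\varphi,\varphi$). \emph{$\mathsf{SMSO}$}: logical and arithmetic rules, plus negative comprehension (from $\vec\varphi\vdash\varphi[\psi[y]/X]$ infer $\vec\varphi\vdash\lnot\lnot\exists X\varphi$), induction restricted to deterministic $\varphi=\delta$, double negation elimination restricted to deterministic formulae, and synchronous comprehension (from $\vec\varphi\vdash\psi[\hat\varphi[y]/X]$ infer $\vec\varphi\vdash\exists X\psi$ with $\hat\varphi$ uniformly bounded by $y$). *)

theory Defs
  imports Main
begin

text \<open>
  Formulae are represented with de Bruijn indices, which makes substitution capture-avoiding and
  identifies formulae up to renaming of bound variables.  Individual and predicate variables
  have separate index spaces: \<open>ExI\<close> binds individual index 0 and \<open>ExP\<close> binds predicate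
  index 0 of its body.  \<open>Mem x X\<close> is $x \in X$, and \<open>Succ x y\<close> says that \<open>y\<close> is the successor of \<open>x\<close>.
\<close>

datatype form =
    Eq nat nat
  | Leq nat nat
  | Succ nat nat
  | IsZero nat
  | Mem nat nat
  | Top
  | Bot
  | And form form
  | Neg form
  | ExI form
  | ExP form

fun deterministic :: "form \<Rightarrow> bool" where
  "deterministic (And \<phi> \<psi>) \<longleftrightarrow> deterministic \<phi> \<and> deterministic \<psi>"
| "deterministic (ExI \<phi>) \<longleftrightarrow> False"
| "deterministic (ExP \<phi>) \<longleftrightarrow> False"
| "deterministic _ \<longleftrightarrow> True"

definition up :: "(nat \<Rightarrow> nat) \<Rightarrow> nat \<Rightarrow> nat" where
  "up f = case_nat 0 (\<lambda>n. Suc (f n))"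

primrec rename :: "(nat \<Rightarrow> nat) \<Rightarrow> (nat \<Rightarrow> nat) \<Rightarrow> form \<Rightarrow> form" where
  "rename f g (Eq x y) = Eq (f x) (f y)"
| "rename f g (Leq x y) = Leq (f x) (f y)"
| "rename f g (Succ x y) = Succ (f x) (f y)"
| "rename f g (IsZero x) = IsZero (f x)"
| "rename f g (Mem x X) = Mem (f x) (g X)"
| "rename f g Top = Top"
| "rename f g Bot = Bot"
| "rename f g (And \<phi> \<psi>) = And (rename f g \<phi>) (rename f g \<psi>)"
| "rename f g (Neg \<phi>) = Neg (rename f g \<phi>)"
| "rename f g (ExI \<phi>) = ExI (rename (up f) g \<phi>)"
| "rename f g (ExP \<phi>) = ExP (rename f (up g) \<phi>)"

definition shiftI :: "form \<Rightarrow> form" where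
  "shiftI = rename Suc id"

definition shiftP :: "form \<Rightarrow> form" where
  "shiftP = rename id Suc"

text \<open>
  A formula $\varphi[x]$ with a distinguished individual variable is a formula whose index 0
  stands for $x$ and whose index \<open>Suc n\<close> stands for the variable \<open>n\<close> of the surrounding scope
  (as for the body of \<open>ExI\<close>); likewise for predicate variables.  Since the only individual terms
  are variables, \<open>instI \<phi> y\<close> is $\varphi[y/x]$, \<open>instP \<phi> Y\<close> is $\varphi[Y/X]$, and
  \<open>substP \<phi> \<psi>\<close> is $\varphi[\psi[y]/X]$.
\<close>

definition instI :: "form \<Rightarrow> nat \<Rightarrow> form" where
  "instI \<phi> y = rename (case_nat y id) id \<phi>"

definition instP :: "form \<Rightarrow> nat \<Rightarrow> form" where
  "instP \<phi> Y = rename id (case_nat Y id) \<phi>"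

text \<open>
  The substitution \<open>\<sigma>\<close> maps each predicate variable \<open>X\<close> to a formula with a distinguished
  individual variable.  Renaming with \<open>up Suc\<close> shifts the other individual variables of that formula
  and keeps the distinguished one; \<open>Mem 0 X\<close> is the formula $(y \in X)[y]$, so it leaves \<open>X\<close> unchanged.
\<close>

primrec substPs :: "(nat \<Rightarrow> form) \<Rightarrow> form \<Rightarrow> form" where
  "substPs \<sigma> (Eq x y) = Eq x y"
| "substPs \<sigma> (Leq x y) = Leq x y"
| "substPs \<sigma> (Succ x y) = Succ x y"
| "substPs \<sigma> (IsZero x) = IsZero x"
| "substPs \<sigma> (Mem x X) = instI (\<sigma> X) x"
| "substPs \<sigma> Top = Top"
| "substPs \<sigma> Bot = Bot"
| "substPs \<sigma> (And \<phi> \<psi>) = And (substPs \<sigma> \<phi>) (substPs \<sigma> \<psi>)"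
| "substPs \<sigma> (Neg \<phi>) = Neg (substPs \<sigma> \<phi>)"
| "substPs \<sigma> (ExI \<phi>) = ExI (substPs (\<lambda>X. rename (up Suc) id (\<sigma> X)) \<phi>)"
| "substPs \<sigma> (ExP \<phi>) = ExP (substPs (case_nat (Mem 0 0) (\<lambda>X. shiftP (\<sigma> X))) \<phi>)"

definition substP :: "form \<Rightarrow> form \<Rightarrow> form" where
  "substP \<phi> \<psi> = substPs (case_nat \<psi> (\<lambda>X. Mem 0 X)) \<phi>"

text \<open>
  \<open>relativize \<theta> \<phi>\<close> is $\varphi|\theta[y]$.  Inside \<open>ExI\<close>, the distinguished index 0 of \<open>\<theta>\<close> coincides
  with the bound variable $x$, so that \<open>\<theta>\<close> itself represents $\theta[x/y]$ there.
\<close>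

primrec relativize :: "form \<Rightarrow> form \<Rightarrow> form" where
  "relativize \<theta> (Eq x y) = Eq x y"
| "relativize \<theta> (Leq x y) = Leq x y"
| "relativize \<theta> (Succ x y) = Succ x y"
| "relativize \<theta> (IsZero x) = IsZero x"
| "relativize \<theta> (Mem x X) = Mem x X"
| "relativize \<theta> Top = Top"
| "relativize \<theta> Bot = Bot"
| "relativize \<theta> (And \<phi> \<psi>) = And (relativize \<theta> \<phi>) (relativize \<theta> \<psi>)"
| "relativize \<theta> (Neg \<phi>) = Neg (relativize \<theta> \<phi>)"
| "relativize \<theta> (ExI \<phi>) = ExI (And \<theta> (relativize (rename (up Suc) id \<theta>) \<phi>))"
| "relativize \<theta> (ExP \<phi>) = ExP (relativize (shiftP \<theta>) \<phi>)"

primrec freeI :: "form \<Rightarrow> nat set" where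
  "freeI (Eq x y) = {x, y}"
| "freeI (Leq x y) = {x, y}"
| "freeI (Succ x y) = {x, y}"
| "freeI (IsZero x) = {x}"
| "freeI (Mem x X) = {x}"
| "freeI Top = {}"
| "freeI Bot = {}"
| "freeI (And \<phi> \<psi>) = freeI \<phi> \<union> freeI \<psi>"
| "freeI (Neg \<phi>) = freeI \<phi>"
| "freeI (ExI \<phi>) = {n. Suc n \<in> freeI \<phi>}"
| "freeI (ExP \<phi>) = freeI \<phi>"

text \<open>\<open>Leq 0 (Suc x)\<close> is $(y \leq x)[y]$.\<close>

definition uniformly_bounded :: "nat \<Rightarrow> form \<Rightarrow> bool" where
  "uniformly_bounded x \<phi> \<longleftrightarrow>
     (\<exists>\<psi>. \<phi> = relativize (Leq 0 (Suc x)) \<psi>) \<and> freeI \<phi> \<subseteq> {x}"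

datatype calculus = MSO | SMSO

text \<open>
  \<open>derivable c \<Gamma> \<phi>\<close> is derivability of the sequent $\Gamma \vdash \varphi$ in the calculus \<open>c\<close>.  The order of the
  formulae in a context is immaterial.  Eigenvariables are the indices freed by
  shifting the context: in \<open>exI_elim\<close> and \<open>exP_elim\<close> the eigenvariable is index 0, in the base case of
  \<open>induction\<close> $z$ is index 0 (so \<open>\<phi>\<close> itself is $\varphi[z/x]$), and in its step $z$ is index 0 and
  $y$ is index 1.
\<close>

inductive derivable :: "calculus \<Rightarrow> form list \<Rightarrow> form \<Rightarrow> bool" for c :: calculus where
  ax: "\<phi> \<in> set \<Gamma> \<Longrightarrow> derivable c \<Gamma> \<phi>"
| cut: "\<lbrakk>derivable c \<Gamma> \<psi>; derivable c (\<psi> # \<Gamma>) \<phi>\<rbrakk> \<Longrightarrow> derivable c \<Gamma> \<phi>"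
| neg_elim: "\<lbrakk>derivable c \<Gamma> \<phi>; derivable c \<Gamma> (Neg \<phi>)\<rbrakk> \<Longrightarrow> derivable c \<Gamma> Bot"
| neg_intro: "derivable c (\<phi> # \<Gamma>) Bot \<Longrightarrow> derivable c \<Gamma> (Neg \<phi>)"
| and_intro: "\<lbrakk>derivable c \<Gamma> \<phi>; derivable c \<Gamma> \<psi>\<rbrakk> \<Longrightarrow> derivable c \<Gamma> (And \<phi> \<psi>)"
| and_elim1: "derivable c \<Gamma> (And \<phi> \<psi>) \<Longrightarrow> derivable c \<Gamma> \<phi>"
| and_elim2: "derivable c \<Gamma> (And \<phi> \<psi>) \<Longrightarrow> derivable c \<Gamma> \<psi>"
| exI_intro: "derivable c \<Gamma> (instI \<phi> y) \<Longrightarrow> derivable c \<Gamma> (ExI \<phi>)"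
| exP_intro: "derivable c \<Gamma> (instP \<phi> Y) \<Longrightarrow> derivable c \<Gamma> (ExP \<phi>)"
| exI_elim: "\<lbrakk>derivable c \<Gamma> (ExI \<phi>); derivable c (\<phi> # map shiftI \<Gamma>) (shiftI \<psi>)\<rbrakk>
    \<Longrightarrow> derivable c \<Gamma> \<psi>"
| exP_elim: "\<lbrakk>derivable c \<Gamma> (ExP \<phi>); derivable c (\<phi> # map shiftP \<Gamma>) (shiftP \<psi>)\<rbrakk>
    \<Longrightarrow> derivable c \<Gamma> \<psi>"
| eq_refl: "derivable c \<Gamma> (Eq x x)"
| eq_subst: "\<lbrakk>derivable c \<Gamma> (instI \<phi> y); derivable c \<Gamma> (Eq y z)\<rbrakk> \<Longrightarrow> derivable c \<Gamma> (instI \<phi> z)"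
| leq_refl: "derivable c \<Gamma> (Leq x x)"
| leq_trans: "\<lbrakk>derivable c \<Gamma> (Leq x y); derivable c \<Gamma> (Leq y z)\<rbrakk> \<Longrightarrow> derivable c \<Gamma> (Leq x z)"
| leq_antisym: "\<lbrakk>derivable c \<Gamma> (Leq x y); derivable c \<Gamma> (Leq y x)\<rbrakk> \<Longrightarrow> derivable c \<Gamma> (Eq x y)"
| zero_exists: "derivable c \<Gamma> (ExI (IsZero 0))"
| zero_unique: "\<lbrakk>derivable c \<Gamma> (IsZero x); derivable c \<Gamma> (IsZero y)\<rbrakk> \<Longrightarrow> derivable c \<Gamma> (Eq x y)"
| succ_exists: "derivable c \<Gamma> (ExI (Succ (Suc x) 0))"
| succ_inj: "\<lbrakk>derivable c \<Gamma> (Succ y x); derivable c \<Gamma> (Succ z x)\<rbrakk> \<Longrightarrow> derivable c \<Gamma> (Eq y z)"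
| succ_unique: "\<lbrakk>derivable c \<Gamma> (Succ x y); derivable c \<Gamma> (Succ x z)\<rbrakk> \<Longrightarrow> derivable c \<Gamma> (Eq y z)"
| succ_nonzero: "\<lbrakk>derivable c \<Gamma> (Succ x y); derivable c \<Gamma> (IsZero y)\<rbrakk> \<Longrightarrow> derivable c \<Gamma> Bot"
| succ_leq: "derivable c \<Gamma> (Succ x y) \<Longrightarrow> derivable c \<Gamma> (Leq x y)"
| leq_succ: "\<lbrakk>derivable c \<Gamma> (Succ y y'); derivable c \<Gamma> (Leq x y'); derivable c \<Gamma> (Neg (Eq x y'))\<rbrakk>
    \<Longrightarrow> derivable c \<Gamma> (Leq x y)"
| dne: "\<lbrakk>c = MSO \<or> c = SMSO \<and> deterministic \<phi>; derivable c \<Gamma> (Neg (Neg \<phi>))\<rbrakk>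
    \<Longrightarrow> derivable c \<Gamma> \<phi>"
| induction: "\<lbrakk>c = MSO \<or> c = SMSO \<and> deterministic \<phi>;
      derivable c (IsZero 0 # map shiftI \<Gamma>) \<phi>;
      derivable c (rename (case_nat 1 (\<lambda>n. n + 2)) id \<phi> # Succ 1 0 # map (shiftI \<circ> shiftI) \<Gamma>)
        (rename (case_nat 0 (\<lambda>n. n + 2)) id \<phi>)\<rbrakk>
    \<Longrightarrow> derivable c \<Gamma> (instI \<phi> x)"
| comprehension: "\<lbrakk>c = MSO; derivable c \<Gamma> (substP \<phi> \<psi>)\<rbrakk> \<Longrightarrow> derivable c \<Gamma> (ExP \<phi>)"
| neg_comprehension: "\<lbrakk>c = SMSO; derivable c \<Gamma> (substP \<phi> \<psi>)\<rbrakk>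
    \<Longrightarrow> derivable c \<Gamma> (Neg (Neg (ExP \<phi>)))"
| sync_comprehension: "\<lbrakk>c = SMSO; uniformly_bounded 0 \<phi>; derivable c \<Gamma> (substP \<psi> \<phi>)\<rbrakk>
    \<Longrightarrow> derivable c \<Gamma> (ExP \<psi>)"

end

theory Submission
  imports Defs
begin

text \<open>
  Double negation is a monad for derivability and, as the language has no primitive universal
  quantifier, it passes through every rule, including the eigenvariable rules.  Negations are
  deterministic, so the restricted induction rule of SMSO, like replacement of equals, applies to
  \<open>Neg (Neg \<phi>)\<close> for arbitrary \<open>\<phi>\<close>; the premises of the other arithmetic rules are atomic or
  negated, hence deterministic, and lose their double negations by the restricted elimination rule.
  Comprehension holds up to double negation in either calculus and subsumes synchronous
  comprehension, so a sequent derivable in one calculus is derivable in the other once its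
  conclusion is doubly negated.
\<close>

lemma derivable_weaken:
  assumes "derivable c \<Gamma> \<phi>" and "set \<Gamma> \<subseteq> set \<Delta>"
  shows "derivable c \<Delta> \<phi>"
  using assms
proof (induction arbitrary: \<Delta> rule: derivable.induct)
  case (cut \<Gamma> \<psi> \<phi>)
  have "set (\<psi> # \<Gamma>) \<subseteq> set (\<psi> # \<Delta>)"
    using cut.prems by auto
  with cut show ?case by (blast intro: derivable.cut)
next
  case (neg_intro \<phi> \<Gamma>)
  have "set (\<phi> # \<Gamma>) \<subseteq> set (\<phi> # \<Delta>)"
    using neg_intro.prems by auto
  with neg_intro show ?case by (blast intro: derivable.neg_intro)
next
  case (exI_elim \<Gamma> \<phi> \<psi>)
  have "set (\<phi> # map shiftI \<Gamma>) \<subseteq> set (\<phi> # map shiftI \<Delta>)"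
    using exI_elim.prems by auto
  with exI_elim show ?case by (blast intro: derivable.exI_elim)
next
  case (exP_elim \<Gamma> \<phi> \<psi>)
  have "set (\<phi> # map shiftP \<Gamma>) \<subseteq> set (\<phi> # map shiftP \<Delta>)"
    using exP_elim.prems by auto
  with exP_elim show ?case by (blast intro: derivable.exP_elim)
next
  case (induction \<phi> \<Gamma> x)
  show ?case
    by (rule derivable.induction[OF induction.hyps(1) induction.IH])
      (use induction.prems in auto)
  \<comment> \<open>In the remaining rules every premise has the context of the conclusion.\<close>
qed (rule derivable.intros;
    (assumption | erule (1) subsetD | erule meta_allE, erule (1) meta_mp))+

lemma derivable_weaken_Cons: "derivable c \<Gamma> \<phi> \<Longrightarrow> derivable c (\<psi> # \<Gamma>) \<phi>"
  by (erule derivable_weaken) auto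

lemma derivable_hd: "derivable c (\<phi> # \<Gamma>) \<phi>"
  by (rule ax) simp

lemma derivable_neg_neg_intro:
  assumes "derivable c \<Gamma> \<phi>"
  shows "derivable c \<Gamma> (Neg (Neg \<phi>))"
proof (rule neg_intro, rule neg_elim)
  show "derivable c (Neg \<phi> # \<Gamma>) \<phi>"
    using assms by (rule derivable_weaken_Cons)
  show "derivable c (Neg \<phi> # \<Gamma>) (Neg \<phi>)"
    by (rule derivable_hd)
qed

lemma derivable_neg_neg_bind:
  assumes \<phi>: "derivable c \<Gamma> (Neg (Neg \<phi>))" and \<psi>: "derivable c (\<phi> # \<Gamma>) (Neg (Neg \<psi>))"
  shows "derivable c \<Gamma> (Neg (Neg \<psi>))"
proof (rule neg_intro, rule neg_elim)
  show "derivable c (Neg \<psi> # \<Gamma>) (Neg \<phi>)"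
  proof (rule neg_intro, rule neg_elim)
    show "derivable c (\<phi> # Neg \<psi> # \<Gamma>) (Neg \<psi>)"
      by (rule ax) simp
    show "derivable c (\<phi> # Neg \<psi> # \<Gamma>) (Neg (Neg \<psi>))"
      by (rule derivable_weaken[OF \<psi>]) auto
  qed
  show "derivable c (Neg \<psi> # \<Gamma>) (Neg (Neg \<phi>))"
    by (rule derivable_weaken_Cons[OF \<phi>])
qed

lemma derivable_neg_neg_map:
  assumes "derivable c \<Gamma> (Neg (Neg \<phi>))" and "derivable c (\<phi> # \<Gamma>) \<psi>"
  shows "derivable c \<Gamma> (Neg (Neg \<psi>))"
  using assms derivable_neg_neg_bind derivable_neg_neg_intro by blast

lemma derivable_neg_neg_iff_deterministic:
  assumes "deterministic \<phi>"
  shows "derivable c \<Gamma> (Neg (Neg \<phi>)) \<longleftrightarrow> derivable c \<Gamma> \<phi>"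
proof
  show "derivable c \<Gamma> \<phi>" if "derivable c \<Gamma> (Neg (Neg \<phi>))"
    using assms that by (cases c) (auto intro: dne)
qed (rule derivable_neg_neg_intro)

lemma derivable_neg_neg_and_intro:
  assumes "derivable c \<Gamma> (Neg (Neg \<phi>))" and "derivable c \<Gamma> (Neg (Neg \<psi>))"
  shows "derivable c \<Gamma> (Neg (Neg (And \<phi> \<psi>)))"
  using assms(1)
proof (rule derivable_neg_neg_bind)
  have "derivable c (\<psi> # \<phi> # \<Gamma>) (And \<phi> \<psi>)"
    by (intro and_intro ax) simp_all
  with derivable_weaken_Cons[OF assms(2)] show "derivable c (\<phi> # \<Gamma>) (Neg (Neg (And \<phi> \<psi>)))"
    by (rule derivable_neg_neg_map)
qed

lemma derivable_neg_neg_exI_elim: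
  assumes ex: "derivable c \<Gamma> (Neg (Neg (ExI \<phi>)))"
    and body: "derivable c (\<phi> # map shiftI \<Gamma>) (Neg (Neg (shiftI \<psi>)))"
  shows "derivable c \<Gamma> (Neg (Neg \<psi>))"
  using ex
proof (rule derivable_neg_neg_bind)
  have "derivable c (\<phi> # map shiftI (ExI \<phi> # \<Gamma>)) (Neg (Neg (shiftI \<psi>)))"
    by (rule derivable_weaken[OF body]) auto
  then show "derivable c (ExI \<phi> # \<Gamma>) (Neg (Neg \<psi>))"
    by (intro exI_elim[OF derivable_hd]) (simp add: shiftI_def)
qed

lemma derivable_neg_neg_exP_elim:
  assumes ex: "derivable c \<Gamma> (Neg (Neg (ExP \<phi>)))"
    and body: "derivable c (\<phi> # map shiftP \<Gamma>) (Neg (Neg (shiftP \<psi>)))"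
  shows "derivable c \<Gamma> (Neg (Neg \<psi>))"
  using ex
proof (rule derivable_neg_neg_bind)
  have "derivable c (\<phi> # map shiftP (ExP \<phi> # \<Gamma>)) (Neg (Neg (shiftP \<psi>)))"
    by (rule derivable_weaken[OF body]) auto
  then show "derivable c (ExP \<phi> # \<Gamma>) (Neg (Neg \<psi>))"
    by (intro exP_elim[OF derivable_hd]) (simp add: shiftP_def)
qed

lemma derivable_neg_neg_eq_subst:
  assumes "derivable c \<Gamma> (Neg (Neg (instI \<phi> y)))" and "derivable c \<Gamma> (Eq y z)"
  shows "derivable c \<Gamma> (Neg (Neg (instI \<phi> z)))"
  using assms eq_subst[where \<phi> = "Neg (Neg \<phi>)"] by (simp add: instI_def)

lemma derivable_neg_neg_induction:
  fixes \<phi> :: form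
  defines "\<phi>y \<equiv> rename (case_nat 1 (\<lambda>n. n + 2)) id \<phi>"
    and "\<phi>z \<equiv> rename (case_nat 0 (\<lambda>n. n + 2)) id \<phi>"
  assumes base: "derivable c (IsZero 0 # map shiftI \<Gamma>) (Neg (Neg \<phi>))"
    and step: "derivable c (\<phi>y # Succ 1 0 # map (shiftI \<circ> shiftI) \<Gamma>) (Neg (Neg \<phi>z))"
  shows "derivable c \<Gamma> (Neg (Neg (instI \<phi> x)))"
proof -
  let ?\<Delta> = "Succ 1 0 # map (shiftI \<circ> shiftI) \<Gamma>"
  have "derivable c (\<phi>y # Neg (Neg \<phi>y) # ?\<Delta>) (Neg (Neg \<phi>z))"
    by (rule derivable_weaken[OF step]) auto
  with derivable_hd have "derivable c (Neg (Neg \<phi>y) # ?\<Delta>) (Neg (Neg \<phi>z))"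
    by (rule derivable_neg_neg_bind)
  with base have "derivable c \<Gamma> (instI (Neg (Neg \<phi>)) x)"
    by (intro induction) (cases c; simp add: \<phi>y_def \<phi>z_def)+
  then show ?thesis by (simp add: instI_def)
qed

lemma derivable_neg_neg_comprehension:
  assumes "derivable c \<Gamma> (Neg (Neg (substP \<phi> \<psi>)))"
  shows "derivable c \<Gamma> (Neg (Neg (ExP \<phi>)))"
  using assms
proof (rule derivable_neg_neg_bind)
  show "derivable c (substP \<phi> \<psi> # \<Gamma>) (Neg (Neg (ExP \<phi>)))"
  proof (cases c)
    case MSO
    then show ?thesis
      by (intro derivable_neg_neg_intro comprehension[OF _ derivable_hd])
  next
    case SMSO
    then show ?thesis by (rule neg_comprehension[OF _ derivable_hd])
  qed
qed

lemma derivable_imp_derivable_neg_neg: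
  assumes "derivable c \<Gamma> \<phi>"
  shows "derivable d \<Gamma> (Neg (Neg \<phi>))"
  using assms
proof (induction rule: derivable.induct)
  case cut
  then show ?case by (blast intro: derivable_neg_neg_bind)
next
  case neg_intro
  then show ?case by (simp add: derivable_neg_neg_iff_deterministic derivable.neg_intro)
next
  case and_intro
  then show ?case by (blast intro: derivable_neg_neg_and_intro)
next
  case exI_elim
  then show ?case by (blast intro: derivable_neg_neg_exI_elim)
next
  case exP_elim
  then show ?case by (blast intro: derivable_neg_neg_exP_elim)
next
  case eq_subst
  then show ?case
    by (simp add: derivable_neg_neg_iff_deterministic derivable_neg_neg_eq_subst)
next
  case dne
  then show ?case by (simp add: derivable_neg_neg_iff_deterministic)
next
  case induction
  then show ?case by (blast intro: derivable_neg_neg_induction)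
next
  case neg_comprehension
  then show ?case by (blast intro: derivable_neg_neg_intro derivable_neg_neg_comprehension)
qed (blast intro: derivable_neg_neg_comprehension
  | (erule derivable_neg_neg_map,
      rule derivable.and_elim1 derivable.and_elim2 derivable.exI_intro derivable.exP_intro,
      rule derivable_hd)
  | (rule derivable_neg_neg_intro, rule derivable.intros;
      simp add: derivable_neg_neg_iff_deterministic))+

theorem theorem3p6:
  fixes \<phi> :: form
  shows "(derivable MSO [] \<phi> \<longrightarrow> derivable SMSO [] (Neg (Neg \<phi>))) \<and>
    (\<forall>\<Gamma>. derivable MSO \<Gamma> \<phi> \<longrightarrow> derivable SMSO \<Gamma> (Neg (Neg \<phi>)))"
  using derivable_imp_derivable_neg_neg by blast

end
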